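(* There is an absolute constant $c>0$ such that the following holds. Let $p$ be a prime of the form $p=6f+1$, let $g$ be a primitive root modulo $p$, and let $\mathcal{H}=(h_n)_{n\ge 0}$ be Hall's sextic residue sequence of period $p$ with respect to $g$. Then for every integer $N\ge 1$ the $N$th linear complexity of $\mathcal{H}$ over $\mathbb{F}_2$ satisfies $$\log\left(\frac{\min\{N,p\}}{p^{1/2}\log^2 p}\right)\le c\, L(\mathcal{H},N).$$
   Context: Hall's sextic residue sequence: let $p=6f+1$ be a prime and $g$ a primitive root modulo $p$. For $\ell=0,1,\ldots,5$ let $C_\ell=\{g^{6i+\ell} \bmod p : i=0,1,\ldots,f-1\}$ be the cyclotomic cosets modulo $p$ of order $6$. Hall's sextic residue sequence $(h_n)_{n\ge 0}$ of period $p$ with respect to $g$ is defined by $h_n=1$ if $n \bmod p\in C_0\cup C_1\cup C_3$, and $h_n=0$ otherwise (in particular $h_n=0$ if $p\mid n$). $N$th linear complexity: for a binary sequence $\mathcal{S}=(s_n)_{n\ge 0}$, viewed over $\mathbb{F}_2$, and an integer $N\ge 1$, $L(\mathcal{S},N)$ is the shortest length $L$ of a linear recurrence relation over $\mathbb{F}_2$ $$s_{n+L}=c_{L-1}s_{n+L-1}+\cdots+c_0s_n,\quad 0\le n\le N-L-1,$$ with $c_0,\ldots,c_{L-1}\in\mathbb{F}_2$, which is satisfied by the first $N$ sequence elements. By convention $L(\mathcal{S},N)=0$ if the first $N$ terms of the sequence are all $0$, and $L(\mathcal{S},N)=N$ if $s_0=s_1=\cdots=s_{N-2}=0$ and $s_{N-1}=1$.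 $\log$ denotes the natural logarithm and $\log^2 p=(\log p)^2$. The inequality is the written-out form of $L(\mathcal{H},N)=\Omega\left(\log\left(\min\{N,p\}/(p^{1/2}\log^2 p)\right)\right)$, where $A=\Omega(B)$ means $B=O(A)$, i.e. $B\le cA$ for a positive absolute constant $c$. *)

theory Defs
  imports Complex_Main "HOL-Library.Z2" "HOL-Number_Theory.Number_Theory"
begin

definition cyclotomic_coset6 :: "nat \<Rightarrow> nat \<Rightarrow> nat \<Rightarrow> nat set" where
  "cyclotomic_coset6 p g l = {g ^ (6 * i + l) mod p | i. i < (p - 1) div 6}"

definition hall_sextic :: "nat \<Rightarrow> nat \<Rightarrow> nat \<Rightarrow> bit" where
  "hall_sextic p g n =
     (if n mod p \<in> cyclotomic_coset6 p g 0 \<union> cyclotomic_coset6 p g 1 \<union> cyclotomic_coset6 p g 3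
      then 1 else 0)"

text \<open>The range \<open>0 \<le> n \<le> N - L - 1\<close> of the recurrence is written \<open>n + L < N\<close> to avoid
  truncated subtraction; it is empty for \<open>L = N\<close>.\<close>

definition has_lin_recurrence :: "(nat \<Rightarrow> bit) \<Rightarrow> nat \<Rightarrow> nat \<Rightarrow> bool" where
  "has_lin_recurrence s N L \<longleftrightarrow>
     (\<exists>c :: nat \<Rightarrow> bit. \<forall>n. n + L < N \<longrightarrow> s (n + L) = (\<Sum>i<L. c i * s (n + i)))"

definition lin_complexity :: "(nat \<Rightarrow> bit) \<Rightarrow> nat \<Rightarrow> nat" where
  "lin_complexity s N = (LEAST L. has_lin_recurrence s N L)"

text \<open>The minimum always exists, and the two usual conventions for the degenerate initial
  segments \<open>0, \<dots>, 0\<close> and \<open>0, \<dots>, 0, 1\<close> are consequences of the definition.\<close>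

lemma has_lin_recurrence_self: "has_lin_recurrence s N N"
  by (simp add: has_lin_recurrence_def)

lemma lin_complexity_zero:
  assumes "\<And>n. n < N \<Longrightarrow> s n = 0"
  shows "lin_complexity s N = 0"
proof -
  have "has_lin_recurrence s N 0"
    using assms by (simp add: has_lin_recurrence_def)
  then show ?thesis
    unfolding lin_complexity_def by (rule Least_eq_0)
qed

lemma lin_complexity_zeros_one:
  assumes "N \<ge> 1" and zeros: "\<And>n. n < N - 1 \<Longrightarrow> s n = 0" and one: "s (N - 1) = 1"
  shows "lin_complexity s N = N"
  unfolding lin_complexity_def
proof (rule Least_equality)
  show "has_lin_recurrence s N N" by (rule has_lin_recurrence_self)
next
  fix L assume "has_lin_recurrence s N L"
  then obtain c :: "nat \<Rightarrow> bit"
    where c: "\<And>n. n + L < N \<Longrightarrow> s (n + L) = (\<Sum>i<L. c i * s (n + i))"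
    by (auto simp: has_lin_recurrence_def)
  show "N \<le> L"
  proof (rule ccontr)
    assume "\<not> N \<le> L"
    then have L: "L < N" by simp
    have "s (N - 1) = (\<Sum>i<L. c i * s (N - 1 - L + i))"
      using c[of "N - 1 - L"] L by simp
    also have "\<dots> = 0"
      using L by (intro sum.neutral) (simp add: zeros)
    finally show False using one by simp
  qed
qed

end

(* A recurrence of length L makes the sequence periodic with some period T \<le> 2 ^ L after at most
   2 ^ L terms (pigeonhole on the 2 ^ L states).  Hence h is constant along the multiples T * m of T
   in the given range, and since the sextic class is multiplicative, the classes of all m in an
   interval avoid a fixed value.  The number of b in B for which x + b lies in a given class has
   small variance over x, because (x + b) / (x + b') runs through the residues other than 1 when
   b and b' are distinct.  This confines the interval to length O(sqrt p). *)

theory Submission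
  imports Defs
begin

section \<open>Periodicity of linear recurrences\<close>

lemma UNIV_bit: "(UNIV :: bit set) = {0, 1}"
  using bit_not_zero_iff by auto

text \<open>Among the \<open>2 ^ L + 1\<close> windows of length \<open>L\<close> starting at
  \<open>0, ..., 2 ^ L\<close> two coincide, say at \<open>i < j\<close>, and the recurrence
  continues both in the same way. The period is \<open>T = j - i\<close>.\<close>

lemma lin_recurrence_eventually_periodic:
  assumes "has_lin_recurrence s N L"
  obtains i T where "0 < T" "i \<le> 2 ^ L" "T \<le> 2 ^ L"
    and "\<And>n. i \<le> n \<Longrightarrow> n + T < N \<Longrightarrow> s (n + T) = s n"
proof -
  from assms obtain c
    where c: "\<And>n. n + L < N \<Longrightarrow> s (n + L) = (\<Sum>i<L. c i * s (n + i))"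
    by (auto simp: has_lin_recurrence_def)
  \<comment> \<open>Since \<open>s\<close> is defined on all of \<open>nat\<close>, a window
    reaching past index \<open>N\<close> still counts as a state; the recurrence itself is applied
    only below \<open>N\<close>.\<close>
  define w where "w n = map (\<lambda>k. s (n + k)) [0..<L]" for n
  let ?W = "{xs :: bit list. set xs \<subseteq> UNIV \<and> length xs = L}"
  have "card ?W = 2 ^ L"
    by (subst card_lists_length_eq) (simp_all add: UNIV_bit numeral_2_eq_2)
  moreover have "finite ?W"
    by (rule finite_lists_length_eq) (simp add: UNIV_bit)
  then have "card (w ` {..2 ^ L}) \<le> card ?W"
    by (rule card_mono) (auto simp: w_def)
  ultimately have "\<not> inj_on w {..2 ^ L}"
    by (intro pigeonhole) simp
  then obtain i j where ij: "i < j" "j \<le> 2 ^ L" "w i = w j"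
    unfolding inj_on_def by (metis atMost_iff nat_neq_iff)
  have windows: "s (i + k) = s (j + k)" if "k < L" for k
  proof -
    have "w i ! k = w j ! k" using ij by simp
    then show ?thesis using that by (simp add: w_def)
  qed
  \<comment> \<open>For \<open>k \<ge> L\<close> both terms are the same linear combination of the
    \<open>L\<close> preceding terms, which agree by induction.\<close>
  have per: "j + k < N \<Longrightarrow> s (j + k) = s (i + k)" for k
  proof (induction k rule: less_induct)
    case (less k)
    show ?case
    proof (cases "k < L")
      case True
      then show ?thesis using windows by simp
    next
      case False
      then have "s (j + k) = (\<Sum>l<L. c l * s (j + (k - L + l)))"
        using c[of "j + (k - L)"] less.prems by (simp add: add.assoc)
      also have "\<dots> = (\<Sum>l<L. c l * s (i + (k - L + l)))"
      proof (intro sum.cong refl)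
        fix l assume "l \<in> {..<L}"
        then have "k - L + l < k" "j + (k - L + l) < N"
          using False less.prems by auto
        then show "c l * s (j + (k - L + l)) = c l * s (i + (k - L + l))"
          by (simp only: less.IH)
      qed
      also have "\<dots> = s (i + k)"
        using c[of "i + (k - L)"] False less.prems ij by (simp add: add.assoc)
      finally show ?thesis .
    qed
  qed
  show thesis
  proof (rule that[of "j - i" i])
    fix n assume "i \<le> n" "n + (j - i) < N"
    then show "s (n + (j - i)) = s n"
      using per[of "n - i"] ij by (simp add: algebra_simps)
  qed (use ij in auto)
qed

lemma has_lin_recurrence_lin_complexity: "has_lin_recurrence s N (lin_complexity s N)"
  unfolding lin_complexity_def by (rule LeastI) (rule has_lin_recurrence_self)

section \<open>Power residue classes\<close>

locale power_residue_classes =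
  fixes p g d :: nat
  assumes prime: "prime p" and primroot: "residue_primroot p g" and d_dvd: "d dvd p - 1"
begin

text \<open>The discrete logarithm to base \<open>g\<close>, reduced modulo \<open>d\<close>. For
  multiples of \<open>p\<close> no exponent exists and the value is an arbitrary number below
  \<open>d\<close>.\<close>

definition cls :: "nat \<Rightarrow> nat" where
  "cls n = (SOME k. [g ^ k = n] (mod p)) mod d"

lemma p_gt_1: "1 < p"
  using prime by (rule prime_gt_1_nat)

lemma d_pos: "0 < d"
  using d_dvd p_gt_1 by (auto intro!: Nat.gr0I)

lemma coprime_g: "coprime p g"
  using primroot by (simp add: residue_primroot_def)

lemma power_cong_iff: "[g ^ i = g ^ j] (mod p) \<longleftrightarrow> [i = j] (mod p - 1)"
  using primroot order_divides_expdiff[of p g i j] prime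
  by (simp add: residue_primroot_def totient_prime)

lemma ex_index:
  assumes "\<not> p dvd n"
  obtains k where "k < p - 1" "[g ^ k = n] (mod p)"
proof -
  have "bij_betw (\<lambda>i. g ^ i mod p) {..<p - 1} (totatives p)"
    using residue_primroot_is_generator[OF p_gt_1 primroot] prime by (simp add: totient_prime)
  moreover have "coprime p n"
    using prime assms by (simp add: prime_imp_coprime)
  then have "n mod p \<in> totatives p"
    using p_gt_1 assms
    by (auto simp: totatives_def coprime_commute dvd_eq_mod_eq_0 intro: less_imp_le)
  ultimately obtain k where "k < p - 1" "n mod p = g ^ k mod p"
    by (auto simp: bij_betw_def)
  then show thesis
    using that by (simp add: cong_def)
qed

text \<open>Exponents representing \<open>n\<close> agree modulo \<open>p - 1\<close>, hence modulo
  its divisor \<open>d\<close>, so the choice in \<open>cls\<close> does not matter.\<close>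

lemma cls_eqI:
  assumes "[g ^ k = n] (mod p)"
  shows "cls n = k mod d"
proof -
  have "[g ^ (SOME k. [g ^ k = n] (mod p)) = n] (mod p)"
    using assms by (rule someI)
  then have "[g ^ (SOME k. [g ^ k = n] (mod p)) = g ^ k] (mod p)"
    using cong_sym[OF assms] by (rule cong_trans)
  then have "[(SOME k. [g ^ k = n] (mod p)) = k] (mod d)"
    unfolding power_cong_iff using d_dvd by (rule cong_dvd_modulus_nat)
  then show ?thesis
    by (simp only: cls_def cong_def)
qed

lemma cls_less: "cls n < d"
  using d_pos by (simp add: cls_def)

lemma cls_mult:
  assumes "\<not> p dvd m" "\<not> p dvd n"
  shows "cls (m * n) = (cls m + cls n) mod d"
proof -
  obtain i j where ij: "[g ^ i = m] (mod p)" "[g ^ j = n] (mod p)"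
    using ex_index[OF assms(1)] ex_index[OF assms(2)] by metis
  then have "[g ^ (i + j) = m * n] (mod p)"
    by (simp add: power_add cong_mult)
  then have "cls (m * n) = (i + j) mod d"
    by (rule cls_eqI)
  also have "\<dots> = (cls m + cls n) mod d"
    using cls_eqI[OF ij(1)] cls_eqI[OF ij(2)] by (simp only: mod_add_eq)
  finally show ?thesis .
qed

text \<open>The quotient \<open>m / n\<close> modulo \<open>p\<close> has index divisible by
  \<open>d\<close>, so it lies in the subgroup generated by \<open>g ^ d\<close>, whose order is
  \<open>(p - 1) div d\<close>.\<close>

lemma cls_eq_imp_cong:
  assumes "\<not> p dvd m" "\<not> p dvd n" "cls m = cls n"
  obtains i where "i < (p - 1) div d" "[m = g ^ (d * i) * n] (mod p)"
proof -
  obtain j where j: "j < p - 1" "[g ^ j = m] (mod p)" using assms(1) by (rule ex_index)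
  obtain k where k: "k < p - 1" "[g ^ k = n] (mod p)" using assms(2) by (rule ex_index)
  \<comment> \<open>The difference \<open>j - k\<close> modulo \<open>p - 1\<close>, with
    \<open>p - 1\<close> added to avoid truncation.\<close>
  define e where "e = (j + (p - 1 - k)) mod (p - 1)"
  have e: "e < p - 1" using p_gt_1 by (simp add: e_def)
  have "[e + k = j] (mod p - 1)"
  proof -
    have "(e + k) mod (p - 1) = (j + (p - 1 - k) + k) mod (p - 1)"
      unfolding e_def by (rule mod_add_left_eq)
    also have "j + (p - 1 - k) + k = j + (p - 1)"
      using k by linarith
    finally show ?thesis by (simp only: cong_def mod_add_self2)
  qed
  then have "[g ^ j = g ^ e * g ^ k] (mod p)"
    unfolding power_add[symmetric] power_cong_iff by (rule cong_sym)
  also have "[g ^ e * g ^ k = g ^ e * n] (mod p)"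
    using k(2) by (intro cong_mult cong_refl)
  finally have m: "[m = g ^ e * n] (mod p)"
    by (rule cong_trans[OF cong_sym[OF j(2)]])
  have "[e + k = j] (mod d)"
    using \<open>[e + k = j] (mod p - 1)\<close> d_dvd by (rule cong_dvd_modulus_nat)
  moreover have "[j = k] (mod d)"
    using assms(3) cls_eqI[OF j(2)] cls_eqI[OF k(2)] by (simp only: cong_def)
  ultimately have "[e + k = 0 + k] (mod d)"
    by (simp add: cong_def)
  then have "d dvd e"
    by (simp only: cong_add_rcancel_nat cong_0_iff)
  then obtain i where i: "e = d * i" by blast
  have "d * i < d * ((p - 1) div d)"
    using e i d_dvd by (simp only: dvd_mult_div_cancel)
  then have "i < (p - 1) div d"
    by simp
  then show thesis
    using that m i by blast
qed

section \<open>Collisions of classes under two shifts\<close>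

text \<open>Equal classes mean \<open>x + b = a * (x + b')\<close> modulo \<open>p\<close> for one
  of the \<open>(p - 1) div d\<close> values \<open>a = g ^ (d * i)\<close>. Each such congruence is
  linear in \<open>x\<close> and has at most one solution.\<close>

lemma card_same_cls_le:
  assumes "\<not> [b = b'] (mod p)"
  shows "card {x \<in> {..<p}. \<not> p dvd x + b \<and> \<not> p dvd x + b' \<and> cls (x + b) = cls (x + b')}
    \<le> (p - 1) div d" (is "card ?R \<le> ?f")
proof -
  let ?S = "\<lambda>i. {x \<in> {..<p}. [x + b = g ^ (d * i) * (x + b')] (mod p)}"
  have one: "card (?S i) \<le> 1" for i
  proof -
    have "x = y" if x: "x \<in> ?S i" and y: "y \<in> ?S i" for x y
    proof -
      let ?a = "int g ^ (d * i)"
      have "[int x + int b = ?a * (int x + int b')] (mod int p)"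
           "[int y + int b = ?a * (int y + int b')] (mod int p)"
        using x y by (simp_all flip: cong_int_iff)
      then have dx: "int p dvd int x + int b - ?a * (int x + int b')"
        and dy: "int p dvd int y + int b - ?a * (int y + int b')"
        by (simp_all add: cong_iff_dvd_diff)
      have "int p dvd (int x - int y) * (1 - ?a)"
        using dvd_diff[OF dx dy] by (simp add: algebra_simps)
      then consider "int p dvd int x - int y" | "int p dvd 1 - ?a"
        using prime by (auto simp: prime_dvd_mult_iff)
      then show ?thesis
      proof cases
        case 1
        then have "[x = y] (mod p)"
          by (simp flip: cong_iff_dvd_diff cong_int_iff)
        then show ?thesis
          using x y by (simp add: cong_less_modulus_unique_nat)
      next
        \<comment> \<open>If \<open>a = 1\<close>, the congruence degenerates to
          \<open>b = b'\<close>, which is excluded.\<close>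
        case 2
        have "int p dvd (int x + int b - ?a * (int x + int b')) - (1 - ?a) * (int x + int b')"
          using 2 dx by (meson dvd_diff dvd_mult2)
        then have "int p dvd int b - int b'"
          by (simp add: algebra_simps)
        then show ?thesis
          using assms by (simp flip: cong_iff_dvd_diff cong_int_iff)
      qed
    qed
    then show ?thesis
      unfolding One_nat_def by (subst card_le_Suc0_iff_eq) auto
  qed
  have "?R \<subseteq> (\<Union>i<?f. ?S i)"
  proof
    fix x assume x: "x \<in> ?R"
    then have "\<not> p dvd x + b" "\<not> p dvd x + b'" "cls (x + b) = cls (x + b')"
      by simp_all
    then obtain i where "i < ?f" "[x + b = g ^ (d * i) * (x + b')] (mod p)"
      by (rule cls_eq_imp_cong)
    with x show "x \<in> (\<Union>i<?f. ?S i)" by blast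
  qed
  then have "card ?R \<le> card (\<Union>i<?f. ?S i)"
    by (intro card_mono) auto
  also have "\<dots> \<le> (\<Sum>i<?f. card (?S i))"
    by (intro card_UN_le) auto
  also have "\<dots> \<le> (\<Sum>i<?f. 1)"
    by (intro sum_mono one)
  finally show ?thesis by simp
qed

lemma card_dvd_shift_le: "card {x \<in> {..<p}. p dvd x + b} \<le> 1"
proof -
  have "x = y" if "x < p" "p dvd x + b" "y < p" "p dvd y + b" for x y
  proof -
    have "[x + b = y + b] (mod p)"
      using that by (simp add: cong_def dvd_eq_mod_eq_0)
    then show ?thesis
      using that by (simp add: cong_add_rcancel_nat cong_less_modulus_unique_nat)
  qed
  then show ?thesis
    unfolding One_nat_def by (subst card_le_Suc0_iff_eq) auto
qed

section \<open>Moments of the shift counts\<close>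

text \<open>Real-valued so that deviations from the mean \<open>card B / d\<close> can be squared.
  The guard removes zero residues, where \<open>cls\<close> carries no information.\<close>

definition shift_count :: "nat set \<Rightarrow> nat \<Rightarrow> nat \<Rightarrow> real" where
  "shift_count B x c = (\<Sum>b\<in>B. of_bool (\<not> p dvd x + b \<and> cls (x + b) = c))"

lemma sum_shift_count:
  "(\<Sum>c<d. shift_count B x c) = (\<Sum>b\<in>B. of_bool (\<not> p dvd x + b))"
proof -
  have "(\<Sum>c<d. of_bool (\<not> p dvd x + b \<and> cls (x + b) = c)) = (of_bool (\<not> p dvd x + b) :: real)"
    for b using cls_less[of "x + b"] by (simp add: of_bool_conj flip: sum_distrib_left)
  then show ?thesis
    unfolding shift_count_def by (subst sum.swap) simp
qed

text \<open>Each \<open>b\<close> loses at most the one \<open>x\<close> with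
  \<open>p dvd x + b\<close>. A lower bound is the right direction, as the first moment enters the
  variance with a negative sign.\<close>

lemma shift_count_first_moment_ge:
  "real (card B) * (real p - 1) \<le> (\<Sum>x<p. \<Sum>c<d. shift_count B x c)"
proof -
  have "real p - 1 \<le> (\<Sum>x<p. of_bool (\<not> p dvd x + b))" for b
  proof -
    have "(\<Sum>x<p. of_bool (\<not> p dvd x + b) :: real) = (\<Sum>x<p. 1 - of_bool (p dvd x + b))"
      by (intro sum.cong) auto
    also have "\<dots> = real p - real (card {x \<in> {..<p}. p dvd x + b})"
      by (simp add: sum_subtractf Int_def)
    finally show ?thesis
      using card_dvd_shift_le[of b] by simp
  qed
  then have "(\<Sum>b\<in>B. real p - 1) \<le> (\<Sum>b\<in>B. \<Sum>x<p. of_bool (\<not> p dvd x + b))"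
    by (intro sum_mono)
  then show ?thesis
    unfolding sum_shift_count by (subst sum.swap) simp
qed

text \<open>Expanding the square counts, over all pairs \<open>(b, b')\<close>, the \<open>x\<close>
  for which \<open>x + b\<close> and \<open>x + b'\<close> share a class: at most \<open>p\<close>
  on the diagonal and \<open>(p - 1) / d\<close> off it.\<close>

lemma shift_count_second_moment_le:
  assumes "finite B" and distinct: "\<And>b b'. b \<in> B \<Longrightarrow> b' \<in> B \<Longrightarrow> [b = b'] (mod p) \<Longrightarrow> b = b'"
  shows "(\<Sum>x<p. \<Sum>c<d. (shift_count B x c)\<^sup>2)
    \<le> real (card B) * p + (real (card B))\<^sup>2 * ((real p - 1) / d)"
proof -
  let ?P = "\<lambda>x b c. \<not> p dvd x + b \<and> cls (x + b) = c"
  let ?R = "\<lambda>b b'. {x \<in> {..<p}. \<not> p dvd x + b \<and> \<not> p dvd x + b' \<and> cls (x + b) = cls (x + b')}"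
  have coll: "(\<Sum>x<p. \<Sum>c<d. of_bool (?P x b c) * of_bool (?P x b' c)) = real (card (?R b b'))"
    for b b'
  proof -
    have "(\<Sum>c<d. of_bool (?P x b c) * of_bool (?P x b' c)) = (of_bool (x \<in> ?R b b') :: real)"
      if "x < p" for x
    proof -
      have "(\<Sum>c<d. of_bool (?P x b c) * of_bool (?P x b' c))
          = (\<Sum>c<d. if c = cls (x + b) then of_bool (x \<in> ?R b b') else (0::real))"
        using that by (intro sum.cong) auto
      then show ?thesis
        using cls_less[of "x + b"] by simp
    qed
    then have "(\<Sum>x<p. \<Sum>c<d. of_bool (?P x b c) * of_bool (?P x b' c))
        = (\<Sum>x<p. of_bool (x \<in> ?R b b') :: real)"
      by (intro sum.cong) auto
    also have "\<dots> = real (card ({..<p} \<inter> ?R b b'))"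
      by (simp add: Int_def)
    also have "{..<p} \<inter> ?R b b' = ?R b b'" by auto
    finally show ?thesis .
  qed
  \<comment> \<open>Diagonal pairs are also allotted \<open>(p - 1) / d\<close>, which makes the sum
    over all pairs uniform.\<close>
  have bound: "real (card (?R b b')) \<le> of_bool (b = b') * p + (real p - 1) / d"
    if "b \<in> B" "b' \<in> B" for b b'
  proof (cases "b = b'")
    case True
    have "card (?R b b') \<le> card {..<p}"
      by (intro card_mono) auto
    then show ?thesis
      using True p_gt_1 by (simp add: add_increasing2)
  next
    case False
    then have "card (?R b b') \<le> (p - 1) div d"
      using distinct that by (intro card_same_cls_le) blast
    then have "real (card (?R b b')) \<le> real ((p - 1) div d)"
      by simp
    also have "\<dots> = (real p - 1) / d"
      using d_dvd p_gt_1 by (simp add: real_of_nat_div)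
    finally show ?thesis
      using False by simp
  qed
  have "(\<Sum>x<p. \<Sum>c<d. (shift_count B x c)\<^sup>2)
      = (\<Sum>x<p. \<Sum>c<d. \<Sum>b\<in>B. \<Sum>b'\<in>B. of_bool (?P x b c) * of_bool (?P x b' c))"
    by (simp only: shift_count_def power2_eq_square sum_product)
  also have "\<dots> = (\<Sum>x<p. \<Sum>b\<in>B. \<Sum>c<d. \<Sum>b'\<in>B. of_bool (?P x b c) * of_bool (?P x b' c))"
    by (intro sum.cong refl sum.swap)
  also have "\<dots> = (\<Sum>b\<in>B. \<Sum>x<p. \<Sum>c<d. \<Sum>b'\<in>B. of_bool (?P x b c) * of_bool (?P x b' c))"
    by (rule sum.swap)
  also have "\<dots> = (\<Sum>b\<in>B. \<Sum>x<p. \<Sum>b'\<in>B. \<Sum>c<d. of_bool (?P x b c) * of_bool (?P x b' c))"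
    by (intro sum.cong refl sum.swap)
  also have "\<dots> = (\<Sum>b\<in>B. \<Sum>b'\<in>B. \<Sum>x<p. \<Sum>c<d. of_bool (?P x b c) * of_bool (?P x b' c))"
    by (intro sum.cong refl sum.swap)
  also have "\<dots> = (\<Sum>b\<in>B. \<Sum>b'\<in>B. real (card (?R b b')))"
    by (simp only: coll)
  also have "\<dots> \<le> (\<Sum>b\<in>B. \<Sum>b'\<in>B. of_bool (b = b') * p + (real p - 1) / d)"
    by (intro sum_mono bound)
  also have "\<dots> = (\<Sum>b\<in>B. p + card B * ((real p - 1) / d))"
  proof (intro sum.cong refl)
    fix b assume "b \<in> B"
    then have "(\<Sum>b'\<in>B. of_bool (b = b') * real p) = p"
      using \<open>finite B\<close> by (simp flip: sum_distrib_right)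
    then show "(\<Sum>b'\<in>B. of_bool (b = b') * p + (real p - 1) / d)
        = p + card B * ((real p - 1) / d)"
      by (simp add: sum.distrib)
  qed
  also have "\<dots> = real (card B) * p + (real (card B))\<^sup>2 * ((real p - 1) / d)"
    by (simp add: power2_eq_square algebra_simps)
  finally show ?thesis .
qed

text \<open>With \<open>k = card B\<close>, the terms of order \<open>k\<^sup>2 * p / d\<close>
  cancel between the two moments and the squared mean. What remains is
  \<open>k * p + k\<^sup>2 / d\<close>, and \<open>k \<le> p\<close>.\<close>

lemma shift_count_variance_le:
  assumes "B \<subseteq> {..<p}"
  shows "(\<Sum>x<p. \<Sum>c<d. (shift_count B x c - card B / d)\<^sup>2) \<le> 2 * card B * p"
proof -
  have fin: "finite B" using assms finite_subset by blast
  have inj: "b = b'" if "b \<in> B" "b' \<in> B" "[b = b'] (mod p)" for b b'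
    using that assms by (auto intro: cong_less_modulus_unique_nat)
  have cB: "card B \<le> p" using card_mono[OF _ assms] by simp
  define k where "k = real (card B)"
  have k: "0 \<le> k" "k \<le> p" using cB by (simp_all add: k_def)
  have d: "1 \<le> real d" using d_pos by simp
  have "(\<Sum>x<p. \<Sum>c<d. (shift_count B x c - k / d)\<^sup>2)
      = (\<Sum>x<p. \<Sum>c<d. (shift_count B x c)\<^sup>2) - 2 * (k / d) * (\<Sum>x<p. \<Sum>c<d. shift_count B x c)
        + p * (d * (k / d)\<^sup>2)"
    by (simp add: power2_diff sum.distrib sum_subtractf sum_distrib_left mult_ac)
  also have "\<dots> \<le> (k * p + k\<^sup>2 * ((real p - 1) / d)) - 2 * (k / d) * (k * (real p - 1))
      + p * (d * (k / d)\<^sup>2)"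
    using shift_count_second_moment_le[OF fin inj] shift_count_first_moment_ge[of B] k d
    by (intro add_mono diff_mono mult_left_mono) (auto simp: k_def)
  also have "\<dots> = k * p + k * k / d"
    using d by (simp add: field_simps power2_eq_square)
  also have "k * k / d \<le> k * p / 1"
    using k d by (intro frac_le mult_mono) auto
  finally show ?thesis by (simp add: k_def mult_ac)
qed

section \<open>Sets and intervals missing a class\<close>

text \<open>For \<open>a\<close> in \<open>A\<close> the count for class \<open>l\<close> is zero,
  so it misses its mean by \<open>card B / d\<close>. Hence \<open>A\<close> contributes
  \<open>card A * (card B / d)\<^sup>2\<close> to a variance of at most
  \<open>2 * card B * p\<close>.\<close>

lemma card_mult_card_le:
  assumes A: "A \<subseteq> {..<p}" and B: "B \<subseteq> {..<p}" and "l < d"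
    and avoid: "\<And>a b. a \<in> A \<Longrightarrow> b \<in> B \<Longrightarrow> cls (a + b) \<noteq> l"
  shows "card A * card B \<le> 2 * d\<^sup>2 * p"
proof (cases "card B = 0")
  case False
  have d: "0 < real d" using d_pos by simp
  have zero: "shift_count B a l = 0" if "a \<in> A" for a
    using avoid that by (auto simp: shift_count_def)
  have "card A * (card B / d)\<^sup>2 = (\<Sum>x\<in>A. (shift_count B x l - card B / d)\<^sup>2)"
    by (simp add: zero)
  also have "\<dots> \<le> (\<Sum>x<p. (shift_count B x l - card B / d)\<^sup>2)"
    using A by (intro sum_mono2) auto
  also have "\<dots> \<le> (\<Sum>x<p. \<Sum>c<d. (shift_count B x c - card B / d)\<^sup>2)"
    using \<open>l < d\<close> by (intro sum_mono member_le_sum) auto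
  also have "\<dots> \<le> 2 * card B * p"
    using B by (rule shift_count_variance_le)
  finally have "(real (card A) * card B) * card B \<le> (2 * (real d)\<^sup>2 * p) * card B"
    using d by (simp add: field_simps power2_eq_square)
  then have "real (card A) * card B \<le> 2 * (real d)\<^sup>2 * p"
    using False by (subst (asm) mult_le_cancel_right_pos) auto
  then have "real (card A * card B) \<le> real (2 * d\<^sup>2 * p)"
    by simp
  then show ?thesis
    by (simp only: of_nat_le_iff)
qed simp

text \<open>The interval is the sumset of \<open>{u..u + K}\<close> and \<open>{0..K}\<close>, each
  with \<open>K + 1\<close> elements.\<close>

lemma interval_avoiding_class_short:
  assumes "u + 2 * K < p" "l < d"
    and "\<And>m. u \<le> m \<Longrightarrow> m \<le> u + 2 * K \<Longrightarrow> cls m \<noteq> l"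
  shows "(K + 1)\<^sup>2 \<le> 2 * d\<^sup>2 * p"
proof -
  have "card {u..u + K} * card {0..K} \<le> 2 * d\<^sup>2 * p"
    using assms by (intro card_mult_card_le[of _ _ l]) auto
  then show ?thesis
    by (simp add: power2_eq_square)
qed

end

section \<open>Hall's sequence\<close>

locale hall = power_residue_classes p g 6 for p g :: nat
begin

text \<open>Powers of \<open>g\<close> are units modulo \<open>p\<close>; conversely an index
  \<open>k < p - 1\<close> splits as \<open>6 * (k div 6) + l\<close> with \<open>k div 6\<close> in
  the range that defines the coset.\<close>

lemma mem_cyclotomic_coset6_iff:
  assumes "l < 6"
  shows "n mod p \<in> cyclotomic_coset6 p g l \<longleftrightarrow> \<not> p dvd n \<and> cls n = l"
proof
  assume "n mod p \<in> cyclotomic_coset6 p g l"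
  then obtain i where "n mod p = g ^ (6 * i + l) mod p"
    by (auto simp: cyclotomic_coset6_def)
  then have *: "[g ^ (6 * i + l) = n] (mod p)"
    by (simp add: cong_def)
  have "coprime p (g ^ (6 * i + l))"
    using coprime_g by simp
  then have "coprime p n"
    using * by (metis cong_imp_coprime coprime_commute)
  then have "\<not> p dvd n"
    using p_gt_1 by (metis coprime_absorb_left nat_dvd_1_iff_1 less_irrefl is_unit_gcd)
  then show "\<not> p dvd n \<and> cls n = l"
    using cls_eqI[OF *] assms by simp
next
  assume n: "\<not> p dvd n \<and> cls n = l"
  then obtain k where k: "k < p - 1" "[g ^ k = n] (mod p)"
    using ex_index[of n] by metis
  then have "k mod 6 = l"
    using cls_eqI n by simp
  then have "k = 6 * (k div 6) + l"
    by (metis mult_div_mod_eq)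
  moreover have "k div 6 < (p - 1) div 6"
    using k(1) d_dvd by (simp add: div_less_iff_less_mult)
  ultimately show "n mod p \<in> cyclotomic_coset6 p g l"
    using k(2) unfolding cyclotomic_coset6_def cong_def by (auto intro!: exI[of _ "k div 6"])
qed

lemma hall_sextic_eq_1_iff: "hall_sextic p g n = 1 \<longleftrightarrow> \<not> p dvd n \<and> cls n \<in> {0, 1, 3}"
  by (auto simp: hall_sextic_def mem_cyclotomic_coset6_iff)

lemma p_ge_7: "7 \<le> p"
  using dvd_imp_le[OF d_dvd] p_gt_1 by simp

lemma hall_sextic_1: "hall_sextic p g 1 = 1"
  using cls_eqI[of 0 1] p_gt_1 by (simp add: hall_sextic_eq_1_iff)

text \<open>Constancy keeps \<open>cls T + cls m\<close> modulo 6 inside \<open>{0, 1, 3}\<close> or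
  inside its complement, so \<open>cls m\<close> misses a value. The bound below \<open>p\<close>
  keeps \<open>T * m\<close> off the multiples of \<open>p\<close>, where the sequence is 0
  regardless of class. The constant is \<open>72 = 2 * 6\<^sup>2\<close>.\<close>

lemma constant_on_multiples_short:
  assumes "0 < T" "0 < u" "T * (u + 2 * K) < p"
    and const: "\<And>m. u \<le> m \<Longrightarrow> m \<le> u + 2 * K \<Longrightarrow> hall_sextic p g (T * m) = v"
  shows "(K + 1)\<^sup>2 \<le> 72 * p"
proof -
  have "u + 2 * K \<le> T * (u + 2 * K)" using \<open>0 < T\<close> by simp
  then have less: "u + 2 * K < p" using assms(3) by linarith
  have side: "(v = 1) = ((cls T + cls m) mod 6 \<in> {0, 1, 3})" if "u \<le> m" "m \<le> u + 2 * K" for m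
  proof -
    have "T * m \<le> T * (u + 2 * K)" using that by simp
    then have "T * m < p" using assms(3) by (rule le_less_trans)
    moreover have "0 < T * m" using assms(1,2) that by simp
    ultimately have nd: "\<not> p dvd T * m" by (simp add: nat_dvd_not_less)
    then have "\<not> p dvd T" "\<not> p dvd m" by auto
    then show ?thesis
      using const[OF that] hall_sextic_eq_1_iff[of "T * m"] nd by (simp add: cls_mult)
  qed
  \<comment> \<open>Classes 0 and 2 lie on different sides of the partition, so one of them is not attained by \<open>T * m\<close>.\<close>
  define r :: nat where "r = (if v = 1 then 2 else 0)"
  \<comment> \<open>The class \<open>m\<close> would need for \<open>T * m\<close> to have class
    \<open>r\<close>. As \<open>cls T < 6\<close>, the subtraction does not truncate.\<close>
  define l where "l = (r + 6 - cls T) mod 6"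
  have "(cls T + l) mod 6 = r"
  proof -
    have "(cls T + l) mod 6 = (cls T + (r + 6 - cls T)) mod 6"
      unfolding l_def by (simp add: mod_add_right_eq)
    also have "\<dots> = r"
      using cls_less[of T] by (simp add: r_def)
    finally show ?thesis .
  qed
  then have "cls m \<noteq> l" if "u \<le> m" "m \<le> u + 2 * K" for m
    using side[OF that] by (auto simp: r_def split: if_splits)
  then have "(K + 1)\<^sup>2 \<le> 2 * 6\<^sup>2 * p"
    using less by (intro interval_avoiding_class_short[of u K l]) (auto simp: l_def)
  then show ?thesis by simp
qed

section \<open>Linear complexity of Hall's sequence\<close>

text \<open>With \<open>q = 2 ^ L\<close> bounding both preperiod and period, the multiples
  \<open>T * m\<close> for \<open>q \<le> m \<le> q + 2 * K\<close> carry a constant value, which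
  forces \<open>K = O(sqrt p)\<close>, while \<open>M\<close> is at most about
  \<open>q\<^sup>2 + 2 * q * K\<close>.\<close>

lemma lin_recurrence_hall_bound:
  assumes rec: "has_lin_recurrence (hall_sextic p g) N L"
  shows "real (min N p) \<le> 21 * 4 ^ L * sqrt p"
proof -
  define M where "M = min N p"
  define q :: nat where "q = 2 ^ L"
  have q: "1 \<le> q" by (simp add: q_def)
  have sp: "1 \<le> sqrt p" using p_gt_1 by simp
  have "real M \<le> 21 * (real q)\<^sup>2 * sqrt p"
  proof (cases "M \<le> q * q")
    case True
    then have "real M \<le> real (q * q)" by (simp only: of_nat_le_iff)
    also have "\<dots> \<le> (21 * (real q)\<^sup>2) * sqrt p"
      using mult_mono[of "(real q)\<^sup>2" "21 * (real q)\<^sup>2" 1 "sqrt p"] sp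
      by (simp add: power2_eq_square)
    finally show ?thesis .
  next
    case False
    obtain i T where T: "0 < T" "i \<le> q" "T \<le> q"
      and per: "\<And>n. i \<le> n \<Longrightarrow> n + T < N \<Longrightarrow> hall_sextic p g (n + T) = hall_sextic p g n"
      using lin_recurrence_eventually_periodic[OF rec] unfolding q_def by metis
    \<comment> \<open>The largest \<open>K\<close> with \<open>q * (q + 2 * K) < M\<close>, so that
      the multiples stay in range for every \<open>T \<le> q\<close>.\<close>
    define K where "K = (M - 1 - q * q) div (2 * q)"
    have "2 * q * K \<le> M - 1 - q * q" by (simp add: K_def)
    moreover have "T * (q + 2 * K) \<le> q * (q + 2 * K)"
      using T by (intro mult_right_mono) auto
    ultimately have range: "T * (q + 2 * K) < M"
      using False by (simp add: algebra_simps)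
    \<comment> \<open>Consecutive multiples differ by the period, and \<open>m \<ge> q\<close> with
      \<open>T \<ge> 1\<close> puts \<open>T * m\<close> past the preperiod.\<close>
    have const: "hall_sextic p g (T * m) = hall_sextic p g (T * q)"
      if "q \<le> m" "m \<le> q + 2 * K" for m
      using that
    proof (induction m rule: dec_induct)
      case (step m)
      have "T * Suc m \<le> T * (q + 2 * K)"
        using step.prems by (intro mult_left_mono) auto
      then have "T * m + T < N"
        using range by (simp add: M_def)
      moreover have "i \<le> T * m"
        using T step.hyps by (metis le_trans mult_le_mono nat_mult_1 Suc_leI One_nat_def)
      ultimately show ?case
        using per[of "T * m"] step by (simp add: add.commute)
    qed simp
    have "(K + 1)\<^sup>2 \<le> 72 * p"
    proof (rule constant_on_multiples_short[OF T(1) _ _ const])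
      show "0 < q" using q by simp
      show "T * (q + 2 * K) < p" using range by (simp add: M_def)
    qed
    then have "real ((K + 1)\<^sup>2) \<le> real (72 * p)"
      by (simp only: of_nat_le_iff)
    \<comment> \<open>The constant 72 is rounded up to the square 81.\<close>
    then have "(real K + 1)\<^sup>2 \<le> (9 * sqrt p)\<^sup>2"
      by (simp add: power_mult_distrib add.commute)
    then have K: "real K + 1 \<le> 9 * sqrt p"
      by (rule power2_le_imp_le) simp
    have "M - 1 - q * q < 2 * q * (K + 1)"
      unfolding K_def using q by (metis Suc_eq_plus1 dividend_less_times_div mult_Suc_right
          mult_pos_pos pos2 less_le_trans zero_less_one add.commute)
    then have "M \<le> q * q + 2 * q * (K + 1)"
      using False by linarith
    then have "real M \<le> real (q * q + 2 * q * (K + 1))"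
      by (simp only: of_nat_le_iff)
    also have "\<dots> = (real q)\<^sup>2 * 1 + 2 * (real q * (real K + 1))"
      by (simp add: power2_eq_square algebra_simps)
    \<comment> \<open>Here \<open>1 \<le> sqrt p\<close> and \<open>q \<le> q\<^sup>2\<close>; the
      total is \<open>19 * q\<^sup>2 * sqrt p\<close>, within the stated 21.\<close>
    also have "\<dots> \<le> (real q)\<^sup>2 * sqrt p + 2 * ((real q)\<^sup>2 * (9 * sqrt p))"
      using sp K q by (intro add_mono mult_left_mono mult_mono) (auto simp: power2_eq_square)
    also have "\<dots> \<le> 21 * (real q)\<^sup>2 * sqrt p"
      by simp
    finally show ?thesis .
  qed
  also have "(real q)\<^sup>2 = 4 ^ L"
    using power_mult[of "2::real" 2 L] power_mult[of "2::real" L 2]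
    by (simp add: q_def mult.commute)
  finally show ?thesis by (simp add: M_def)
qed

lemma ln_le_lin_complexity:
  assumes "1 \<le> N"
  shows "ln (real (min N p) / (sqrt (real p) * (ln (real p))\<^sup>2))
    \<le> 23 * real (lin_complexity (hall_sextic p g) N)"
proof -
  define L where "L = lin_complexity (hall_sextic p g) N"
  have rec: "has_lin_recurrence (hall_sextic p g) N L"
    unfolding L_def by (rule has_lin_recurrence_lin_complexity)
  define x where "x = real (min N p) / (sqrt p * (ln p)\<^sup>2)"
  have sp: "1 \<le> sqrt p" using p_gt_1 by simp
  have "exp 1 \<le> (3::real)" by (rule exp_le)
  then have "1 \<le> ln (real p)"
    using p_ge_7 by (simp add: ln_ge_iff)
  then have lnp: "1 \<le> (ln (real p))\<^sup>2" by simp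
  have x_pos: "0 < x"
    using assms p_gt_1 sp lnp unfolding x_def by (intro divide_pos_pos mult_pos_pos) auto
  have x_le: "x \<le> real (min N p) / sqrt p"
    using sp lnp unfolding x_def
    by (intro divide_left_mono) (auto intro!: mult_pos_pos)
  have "ln x \<le> 23 * real L"
  \<comment> \<open>For \<open>L = 0\<close> the constant \<open>ln 21\<close> cannot be absorbed.
    But the sequence takes the value 1 at index 1, so \<open>N = 1\<close> and the logarithm is not
    positive.\<close>
  proof (cases "L = 0")
    case True
    then have "\<not> 1 < N"
      using rec hall_sextic_1 by (auto simp: has_lin_recurrence_def)
    then have "N = 1" using assms by simp
    then have "real (min N p) / sqrt p \<le> 1"
      using sp by simp
    then show ?thesis
      using x_le x_pos True by simp
  next
    case False
    have "real (min N p) / sqrt p \<le> 21 * 4 ^ L"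
      using lin_recurrence_hall_bound[OF rec] sp by (simp add: divide_le_eq)
    then have "ln x \<le> ln (21 * 4 ^ L)"
      using x_le x_pos by simp
    also have "\<dots> = ln 21 + real L * ln 4"
      by (simp add: ln_mult ln_realpow)
    \<comment> \<open>The bound \<open>ln y \<le> y - 1\<close> at 21 and 4 gives 20 and 3; their
      sum is the final constant 23.\<close>
    also have "\<dots> \<le> 20 * real L + real L * 3"
      using False ln_le_minus_one[of "21::real"] ln_le_minus_one[of "4::real"]
      by (intro add_mono mult_left_mono) auto
    finally show ?thesis by simp
  qed
  then show ?thesis by (simp add: x_def L_def)
qed

end

theorem mainTheorem3:
  shows "\<exists>c::real. c > 0 \<and>
    (\<forall>p f g :: nat. prime p \<and> p = 6 * f + 1 \<and> residue_primroot p g \<longrightarrow>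
      (\<forall>N::nat. N \<ge> 1 \<longrightarrow>
        ln (real (min N p) / (sqrt (real p) * (ln (real p))\<^sup>2))
          \<le> c * real (lin_complexity (hall_sextic p g) N)))"
proof (intro exI[of _ "23::real"] conjI allI impI)
  fix p f g N :: nat
  assume "prime p \<and> p = 6 * f + 1 \<and> residue_primroot p g" and "1 \<le> N"
  then interpret hall p g
    by unfold_locales auto
  show "ln (real (min N p) / (sqrt (real p) * (ln (real p))\<^sup>2))
      \<le> 23 * real (lin_complexity (hall_sextic p g) N)"
    using \<open>1 \<le> N\<close> by (rule ln_le_lin_complexity)
qed simp

end
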